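(* Let $\Phi=\tfrac12\|\cdot\|_2^2$ and let $\mathcal X\subset\mathbb R_{\ge0}^N$ be a nonempty compact set. Let $F=G_y^{\mathrm{KL}}(A\,\cdot)$. Then for any $K\ge1$ the best (BRSC) constant of $F$ with respect to $\Phi$, $\mathcal X$ and $K$ is $C_K=0$; that is, there is no $C>0$ such that $$\langle\nabla F(x)-\nabla F(x'),x-x'\rangle\ge C\,\|x-x'\|_2^2$$ for all $x\in\mathcal X$ and all $x'\in\mathbb R_{\ge0}^N$ with $x'\neq x$ and $\|x-x'\|_0\le K$.
   Context: $\|x\|_0$ is the number of nonzero entries of $x$. Setting (Poisson regression): $A\in\mathbb R_{\ge0}^{M\times N}$ has no column entirely zero, $b\in\mathbb R_{>0}^M$, $y\in\mathbb Z_{\ge0}^M$, and for $w\in\mathbb R_{\ge0}^M$ $$G_y^{\mathrm{KL}}(w)=\sum_{j=1}^M g^{\mathrm{KL}}_{y_j}(w_j+b_j),\qquad g_y^{\mathrm{KL}}(z)=z+y\log(y/z)-y\quad(0\log0=0).$$ The gradient of $F$ is $\nabla F(x)=A^T\nabla G_y^{\mathrm{KL}}(Ax)$ with $[\nabla G^{\mathrm{KL}}_y(w)]_j=1-y_j/(w_j+b_j)$. (BRSC) for $F$ with respect to $\Phi$, $\mathcal X$, $K$ asks for a constant $C_K>0$ with $D_F^{\mathrm{symm}}(x,x')\ge C_KD_\Phi^{\mathrm{symm}}(x,x')$ for all $x\in\mathcal X$ and admissible $x'\neq x$ with $\|x-x'\|_0\le K$, where $D_H^{\mathrm{symm}}(x,x')=\langle\nabla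 H(x')-\nabla H(x),x'-x\rangle$; here $D_\Phi^{\mathrm{symm}}(x,x')=\|x-x'\|_2^2$. *)

theory Defs
  imports "HOL-Analysis.Analysis"
begin

definition l0_norm :: "real ^ 'n \<Rightarrow> nat" where
  "l0_norm x = card {i. x $ i \<noteq> 0}"

definition nonneg_orthant :: "(real ^ 'n) set" where
  "nonneg_orthant = {x. \<forall>i. 0 \<le> x $ i}"

text \<open>
  The gradient is only meaningful where the function is differentiable. The functions
  considered here are given by total expressions that are differentiable in a neighbourhood
  of every point of the nonnegative orthant, its boundary included.
\<close>

definition gradient :: "('a::real_inner \<Rightarrow> real) \<Rightarrow> 'a \<Rightarrow> 'a" where
  "gradient H x = (THE D. GDERIV H x :> D)"

lemma gradient_eqI:
  assumes "GDERIV H x :> D"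
  shows "gradient H x = D"
  unfolding gradient_def
proof (rule the_equality)
  fix D' assume "GDERIV H x :> D'"
  then have "(\<lambda>h. inner h D') = (\<lambda>h. inner h D)"
    using assms unfolding gderiv_def by (rule has_derivative_unique)
  then have "inner (D' - D) D' = inner (D' - D) D" by metis
  then have "inner (D' - D) (D' - D) = 0" by (simp add: inner_diff_right)
  then show "D' = D" by simp
qed (fact assms)

definition bregman_symm :: "('a::real_inner \<Rightarrow> real) \<Rightarrow> 'a \<Rightarrow> 'a \<Rightarrow> real" where
  "bregman_symm H x x' = inner (gradient H x' - gradient H x) (x' - x)"

text \<open>
  The inequality of the Bregman restricted strong convexity condition with constant \<open>C\<close>,
  where \<open>S\<close> is the set of admissible \<open>x'\<close>. The condition itself asks for some \<open>C > 0\<close>;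
  the sign of \<open>C\<close> is left open here so that \<open>C = 0\<close> can be the best constant.
\<close>

definition brsc_ineq ::
  "(real ^ 'n \<Rightarrow> real) \<Rightarrow> (real ^ 'n \<Rightarrow> real) \<Rightarrow> (real ^ 'n) set \<Rightarrow> (real ^ 'n) set \<Rightarrow> nat \<Rightarrow> real \<Rightarrow> bool"
where
  "brsc_ineq F \<Phi> S X K C \<longleftrightarrow>
     (\<forall>x\<in>X. \<forall>x'\<in>S. x' \<noteq> x \<and> l0_norm (x - x') \<le> K \<longrightarrow>
        bregman_symm F x x' \<ge> C * bregman_symm \<Phi> x x')"

definition is_best_brsc_const ::
  "(real ^ 'n \<Rightarrow> real) \<Rightarrow> (real ^ 'n \<Rightarrow> real) \<Rightarrow> (real ^ 'n) set \<Rightarrow> (real ^ 'n) set \<Rightarrow> nat \<Rightarrow> real \<Rightarrow> bool"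
where
  "is_best_brsc_const F \<Phi> S X K C \<longleftrightarrow>
     brsc_ineq F \<Phi> S X K C \<and> (\<forall>C'. brsc_ineq F \<Phi> S X K C' \<longrightarrow> C' \<le> C)"

text \<open>For \<open>y = 0\<close> the logarithmic term vanishes, in accordance with \<open>0 log 0 = 0\<close>.\<close>

definition kl_g :: "nat \<Rightarrow> real \<Rightarrow> real" where
  "kl_g y z = z + real y * ln (real y / z) - real y"

definition kl_G :: "real ^ 'm \<Rightarrow> nat ^ 'm \<Rightarrow> real ^ 'm \<Rightarrow> real" where
  "kl_G b y w = (\<Sum>j\<in>UNIV. kl_g (y $ j) (w $ j + b $ j))"

end

theory Submission
  imports Defs
begin

text \<open>
  With \<open>w = A x\<close> and \<open>w' = A x'\<close>, the symmetrised Bregman divergence of \<open>F\<close> is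
  \<open>\<Sum>j. y j * (w j - w' j)\<^sup>2 / ((w j + b j) * (w' j + b j))\<close>. It is nonnegative, but along a ray
  \<open>x' = x + t e i\<close> it grows at most linearly in \<open>t\<close>, whereas the divergence of \<open>\<Phi>\<close> equals \<open>t\<^sup>2\<close>.
\<close>

definition kl_grad :: "real ^ 'm \<Rightarrow> nat ^ 'm \<Rightarrow> real ^ 'm \<Rightarrow> real ^ 'm" where
  "kl_grad b y w = (\<chi> j. 1 - real (y $ j) / (w $ j + b $ j))"

lemma DERIV_kl_g:
  assumes "0 < z"
  shows "(kl_g n has_real_derivative 1 - real n / z) (at z)"
\<comment> \<open>Differentiating \<open>ln (n / z)\<close> requires a positive argument, so
  \<open>n = 0\<close>, where the logarithmic term is multiplied by zero, is treated apart.\<close>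
proof (cases "n = 0")
  case True
  then show ?thesis by (simp add: kl_g_def[abs_def])
next
  case False
  then show ?thesis
    unfolding kl_g_def[abs_def] using assms
    by (auto intro!: derivative_eq_intros simp: field_simps power2_eq_square)
qed

lemma kl_G_has_derivative:
  assumes "\<And>j. 0 < w $ j + b $ j"
  shows "(kl_G b y has_derivative (\<lambda>h. inner h (kl_grad b y w))) (at w)"
proof -
  have "((\<lambda>w. kl_g (y $ j) (w $ j + b $ j)) has_derivative
      (\<lambda>h. h $ j * (1 - real (y $ j) / (w $ j + b $ j)))) (at w)" for j
  proof -
    have "((\<lambda>w. w $ j + b $ j) has_derivative (\<lambda>h. h $ j)) (at w)"
      by (auto intro!: derivative_eq_intros bounded_linear_imp_has_derivative bounded_linear_vec_nth)
    from has_derivative_compose[OF this DERIV_kl_g[OF assms, unfolded has_field_derivative_def]]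
    show ?thesis by (simp add: mult.commute)
  qed
  then show ?thesis
    unfolding kl_G_def[abs_def]
    by (auto intro!: derivative_eq_intros simp: inner_vec_def kl_grad_def)
qed

text \<open>Chain rule: the inner map is linear, and moving it across the inner product turns
  \<open>A\<close> into its adjoint \<open>transpose A\<close>.\<close>

lemma gradient_kl_G_comp:
  fixes A :: "real ^ 'n ^ 'm"
  assumes "\<And>j. 0 < (A *v x) $ j + b $ j"
  shows "gradient (\<lambda>x. kl_G b y (A *v x)) x = transpose A *v kl_grad b y (A *v x)"
proof (rule gradient_eqI)
  have "((*v) A has_derivative (*v) A) (at x)"
    by (simp add: bounded_linear_imp_has_derivative)
  from has_derivative_compose[OF this kl_G_has_derivative[OF assms]]
  show "GDERIV (\<lambda>x. kl_G b y (A *v x)) x :> transpose A *v kl_grad b y (A *v x)"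
    unfolding gderiv_def by (simp add: dot_lmul_matrix inner_commute[of _ "_ v* _"] inner_commute[of "A *v _"])
qed

text \<open>The transpose in the gradient moves back onto \<open>x' - x\<close>. Writing
  \<open>w = A *v x\<close> and \<open>w' = A *v x'\<close>, the constants 1 in the two gradients
  cancel, and \<open>1 / (w + b) - 1 / (w' + b) = (w' - w) / ((w + b) * (w' + b))\<close> in each
  coordinate supplies the second factor of the square.\<close>

lemma bregman_symm_kl:
  fixes A :: "real ^ 'n ^ 'm"
  assumes x: "\<And>j. 0 < (A *v x) $ j + b $ j" and x': "\<And>j. 0 < (A *v x') $ j + b $ j"
  shows "bregman_symm (\<lambda>x. kl_G b y (A *v x)) x x' =
    (\<Sum>j\<in>UNIV. real (y $ j) * ((A *v (x' - x)) $ j)\<^sup>2 /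
      (((A *v x) $ j + b $ j) * ((A *v x') $ j + b $ j)))"
proof -
  have "bregman_symm (\<lambda>x. kl_G b y (A *v x)) x x' =
      inner (kl_grad b y (A *v x') - kl_grad b y (A *v x)) (A *v (x' - x))"
    by (simp add: bregman_symm_def gradient_kl_G_comp[OF x] gradient_kl_G_comp[OF x']
        inner_diff_left dot_lmul_matrix)
  also have "\<dots> = (\<Sum>j\<in>UNIV. real (y $ j) * ((A *v (x' - x)) $ j)\<^sup>2 /
      (((A *v x) $ j + b $ j) * ((A *v x') $ j + b $ j)))"
    unfolding inner_vec_def
  proof (rule sum.cong)
    fix j
    show "inner ((kl_grad b y (A *v x') - kl_grad b y (A *v x)) $ j) ((A *v (x' - x)) $ j) =
      real (y $ j) * ((A *v (x' - x)) $ j)\<^sup>2 /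
        (((A *v x) $ j + b $ j) * ((A *v x') $ j + b $ j))"
      using x[of j] x'[of j]
      by (simp add: kl_grad_def matrix_vector_mult_diff_distrib field_simps power2_eq_square)
  qed simp
  finally show ?thesis .
qed

lemma bregman_symm_half_norm_sq:
  "bregman_symm (\<lambda>x. 1 / 2 * (norm x)\<^sup>2) x x' = (norm (x - x'))\<^sup>2"
proof -
  have "gradient (\<lambda>x::'a. 1 / 2 * (norm x)\<^sup>2) z = z" for z
    unfolding power2_norm_eq_inner
    by (rule gradient_eqI)
      (auto intro!: derivative_eq_intros simp: gderiv_def inner_commute)
  then show ?thesis
    by (simp add: bregman_symm_def norm_minus_commute flip: power2_norm_eq_inner)
qed

lemma matrix_vector_nonneg:
  fixes A :: "real ^ 'n ^ 'm"
  assumes "\<And>j i. 0 \<le> A $ j $ i" and "x \<in> nonneg_orthant"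
  shows "0 \<le> (A *v x) $ j"
  using assms by (auto simp: matrix_vector_mult_def nonneg_orthant_def intro!: sum_nonneg)

text \<open>The numerators are quadratic in the step, but the shifted denominator is at least as
  large as the step and absorbs one of its two factors. What remains is linear in \<open>t\<close>,
  with a slope independent of \<open>x\<close>.\<close>

lemma bregman_symm_kl_ray_le:
  fixes A :: "real ^ 'n ^ 'm"
  assumes A: "\<And>j i. 0 \<le> A $ j $ i" and b: "\<And>j. 0 < b $ j"
    and x: "x \<in> nonneg_orthant" and t: "0 < t"
  shows "bregman_symm (\<lambda>x. kl_G b y (A *v x)) x (x + t *\<^sub>R axis i 1) \<le>
    t * (\<Sum>j\<in>UNIV. real (y $ j) * A $ j $ i / b $ j)"
proof -
  have Ax: "0 \<le> (A *v x) $ j" for j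
    using matrix_vector_nonneg[OF A x] .
  have step: "(A *v (t *\<^sub>R axis i 1)) $ j = t * A $ j $ i" for j
    by (simp add: matrix_vector_mult_scaleR matrix_vector_mult_basis column_def)
  have pos: "0 < (A *v x) $ j + b $ j" for j
    using Ax[of j] b[of j] by simp
  have pos': "0 < (A *v (x + t *\<^sub>R axis i 1)) $ j + b $ j" for j
  proof -
    have "0 \<le> t * A $ j $ i" using A t by simp
    then show ?thesis
      using pos[of j] unfolding matrix_vector_right_distrib by (simp add: step)
  qed
  have "real (y $ j) * (t * A $ j $ i)\<^sup>2 /
      (((A *v x) $ j + b $ j) * ((A *v x) $ j + t * A $ j $ i + b $ j)) \<le>
      t * (real (y $ j) * A $ j $ i / b $ j)" for j
  proof -
    define s where "s = t * A $ j $ i"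
    have s: "0 \<le> s" using A t by (simp add: s_def)
    have "s\<^sup>2 * b $ j \<le> s * (((A *v x) $ j + b $ j) * ((A *v x) $ j + s + b $ j))"
    proof -
      \<comment> \<open>The shifted factor is bounded below by \<open>s\<close> and the unshifted
        one by \<open>b $ j\<close>.\<close>
      have "s * b $ j \<le> ((A *v x) $ j + s + b $ j) * ((A *v x) $ j + b $ j)"
        using s Ax[of j] b[of j] by (intro mult_mono) auto
      from mult_left_mono[OF this s] show ?thesis
        by (simp add: power2_eq_square mult_ac)
    qed
    then have "s\<^sup>2 / (((A *v x) $ j + b $ j) * ((A *v x) $ j + s + b $ j)) \<le> s / b $ j"
      using s pos[of j] Ax[of j] b[of j] by (simp add: divide_simps)
    from mult_left_mono[OF this, of "real (y $ j)"] show ?thesis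
      by (simp add: s_def mult_ac)
  qed
  then show ?thesis
    by (simp add: bregman_symm_kl[OF pos pos'] step matrix_vector_right_distrib
        sum_distrib_left sum_mono)
qed

theorem proposition2p6:
  fixes A :: "real ^ 'n ^ 'm" and b :: "real ^ 'm" and y :: "nat ^ 'm"
    and X :: "(real ^ 'n) set" and K :: nat
    and \<Phi> F :: "real ^ 'n \<Rightarrow> real"
  assumes A_nonneg: "\<And>j i. 0 \<le> A $ j $ i"
    and A_columns: "\<And>i. column i A \<noteq> 0"
    and b_pos: "\<And>j. 0 < b $ j"
    and X: "X \<noteq> {}" "compact X" "X \<subseteq> nonneg_orthant"
    and K: "1 \<le> K"
    and \<Phi>: "\<Phi> = (\<lambda>x. 1 / 2 * (norm x)\<^sup>2)"
    and F: "F = (\<lambda>x. kl_G b y (A *v x))"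
  shows "is_best_brsc_const F \<Phi> nonneg_orthant X K 0 \<and>
    \<not> (\<exists>C>0. \<forall>x\<in>X. \<forall>x'\<in>nonneg_orthant. x' \<noteq> x \<and> l0_norm (x - x') \<le> K \<longrightarrow>
          inner (gradient F x - gradient F x') (x - x') \<ge> C * (norm (x - x'))\<^sup>2)"
proof -
  have pos: "0 < (A *v x) $ j + b $ j" if "x \<in> nonneg_orthant" for x j
    using matrix_vector_nonneg[OF A_nonneg that, of j] b_pos[of j] by simp
  \<comment> \<open>Every summand in the closed form of the divergence is nonnegative.\<close>
  have lower: "brsc_ineq F \<Phi> nonneg_orthant X K 0"
    unfolding brsc_ineq_def
  proof (intro ballI impI)
    fix x x' :: "real ^ 'n" assume "x \<in> X" "x' \<in> nonneg_orthant"
    with X have "x \<in> nonneg_orthant" "x' \<in> nonneg_orthant" by auto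
    then show "0 * bregman_symm \<Phi> x x' \<le> bregman_symm F x x'"
      unfolding F by (auto simp: bregman_symm_kl pos intro!: sum_nonneg divide_nonneg_pos)
  qed
  have upper: "C \<le> 0" if C: "brsc_ineq F \<Phi> nonneg_orthant X K C" for C
  proof (rule ccontr)
    assume "\<not> C \<le> 0"
    then have "0 < C" by simp
    obtain x where x: "x \<in> X" using X by auto
    then have x0: "x \<in> nonneg_orthant" using X by auto
    fix i :: 'n
    define M where "M = (\<Sum>j\<in>UNIV. real (y $ j) * A $ j $ i / b $ j)"
    have M: "0 \<le> M"
      unfolding M_def using A_nonneg b_pos by (auto intro!: sum_nonneg divide_nonneg_pos)
    \<comment> \<open>Chosen so that \<open>C * t = M + C\<close> exceeds \<open>M\<close>; the
      added 1 also keeps \<open>t\<close> positive when \<open>M = 0\<close>.\<close>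
    define t where "t = M / C + 1"
    have t: "0 < t" using M \<open>0 < C\<close> by (simp add: t_def add_nonneg_pos)
    let ?x' = "x + t *\<^sub>R axis i 1"
    have "?x' \<in> nonneg_orthant"
      using x0 t by (auto simp: nonneg_orthant_def axis_def)
    moreover have "?x' \<noteq> x"
      using t by (simp add: axis_eq_0_iff)
    \<comment> \<open>Only one coordinate changes, so the perturbation is admissible for every K
      from 1 on.\<close>
    moreover have "l0_norm (x - ?x') \<le> K"
    proof -
      have "{k. (x - ?x') $ k \<noteq> 0} = {i}" using t by (auto simp: axis_def)
      then show ?thesis using K by (simp add: l0_norm_def)
    qed
    ultimately have "C * bregman_symm \<Phi> x ?x' \<le> bregman_symm F x ?x'"
      using C x unfolding brsc_ineq_def by blast
    also have "\<dots> \<le> t * M"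
      unfolding F M_def by (rule bregman_symm_kl_ray_le[OF A_nonneg b_pos x0 t])
    finally have "t * (C * t) \<le> t * M"
      unfolding \<Phi> bregman_symm_half_norm_sq by (simp add: power2_eq_square norm_axis_1 mult_ac)
    then have "C * t \<le> M" using t by simp
    then show False using \<open>0 < C\<close> by (simp add: t_def distrib_left)
  qed
  \<comment> \<open>The two expressions differ by a sign in both arguments of the inner
    product.\<close>
  have sym: "inner (gradient F x - gradient F x') (x - x') = bregman_symm F x x'" for x x'
    unfolding bregman_symm_def by (simp add: inner_diff_left inner_diff_right)
  \<comment> \<open>This identifies the inequality of the second claim with
    \<open>brsc_ineq\<close>, so that \<open>upper\<close> excludes every positive constant there as
    well.\<close>
  have "brsc_ineq F \<Phi> nonneg_orthant X K C \<longleftrightarrow>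
      (\<forall>x\<in>X. \<forall>x'\<in>nonneg_orthant. x' \<noteq> x \<and> l0_norm (x - x') \<le> K \<longrightarrow>
        C * (norm (x - x'))\<^sup>2 \<le> bregman_symm F x x')" for C
    unfolding brsc_ineq_def \<Phi> bregman_symm_half_norm_sq ..
  then show ?thesis
    unfolding is_best_brsc_const_def sym using lower upper by (metis not_le)
qed

end
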